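(* Let $\Gamma$ be a $2$-walk-regular graph which is not a complete multipartite graph, with valency $k\geq 3$. Assume that $\Gamma$ has a $2$-walk-regular idempotent of rank $m$ for an eigenvalue $\theta\neq\pm k$. Then $k\leq \frac{(m+2)(m-1)}{2}$.
   Context: All graphs are finite, simple and connected, with adjacency matrix $A$. For $j\geq 0$, $A_j$ is the distance-$j$ matrix: $(A_j)_{xy}=1$ if $\mathrm{dist}(x,y)=j$ and $0$ otherwise. A graph is $t$-walk-regular if it has diameter at least $t$ and for every $\ell\geq0$ the number of walks of length $\ell$ between $x$ and $y$ depends only on $\mathrm{dist}(x,y)$ whenever $\mathrm{dist}(x,y)\leq t$; such a graph is regular. A $t$-walk-regular idempotent for an eigenvalue $\theta$ is a nonzero real symmetric matrix $E$ with $E^2=E$, $AE=\theta E$, and such that there are constants $\alpha_0,\dots,\alpha_t$ with $A_j\circ E=\alpha_jA_j$ for $0\leq j\leq t$ ($\circ$ the entrywise product). *)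

theory Defs
  imports "HOL-Analysis.Analysis" "HOL-Library.Disjoint_Sets"
begin

text \<open>A graph is given by its adjacency relation; the vertex set is all of a finite type.\<close>

definition simple_graph :: "('v \<Rightarrow> 'v \<Rightarrow> bool) \<Rightarrow> bool" where
  "simple_graph adj \<longleftrightarrow> symp adj \<and> irreflp adj"

text \<open>A walk of length \<open>l\<close> is the list of its \<open>l + 1\<close> vertices.\<close>

definition walks :: "('v \<Rightarrow> 'v \<Rightarrow> bool) \<Rightarrow> nat \<Rightarrow> 'v \<Rightarrow> 'v \<Rightarrow> 'v list set" where
  "walks adj l x y =
     {xs. length xs = Suc l \<and> successively adj xs \<and> hd xs = x \<and> last xs = y}"

definition connected_graph :: "('v \<Rightarrow> 'v \<Rightarrow> bool) \<Rightarrow> bool" where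
  "connected_graph adj \<longleftrightarrow> (\<forall>x y. \<exists>l. walks adj l x y \<noteq> {})"

text \<open>The distance and the diameter are meaningful for connected graphs only.\<close>

definition graph_dist :: "('v \<Rightarrow> 'v \<Rightarrow> bool) \<Rightarrow> 'v \<Rightarrow> 'v \<Rightarrow> nat" where
  "graph_dist adj x y = (LEAST l. walks adj l x y \<noteq> {})"

definition graph_diameter :: "('v::finite \<Rightarrow> 'v \<Rightarrow> bool) \<Rightarrow> nat" where
  "graph_diameter adj = Max {graph_dist adj x y | x y. True}"

definition regular_graph :: "('v \<Rightarrow> 'v \<Rightarrow> bool) \<Rightarrow> nat \<Rightarrow> bool" where
  "regular_graph adj k \<longleftrightarrow> (\<forall>x. card {y. adj x y} = k)"

definition complete_multipartite :: "('v \<Rightarrow> 'v \<Rightarrow> bool) \<Rightarrow> bool" where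
  "complete_multipartite adj \<longleftrightarrow>
     (\<exists>P. partition_on UNIV P \<and> (\<forall>x y. adj x y \<longleftrightarrow> \<not> (\<exists>p\<in>P. x \<in> p \<and> y \<in> p)))"

definition walk_regular :: "nat \<Rightarrow> ('v::finite \<Rightarrow> 'v \<Rightarrow> bool) \<Rightarrow> bool" where
  "walk_regular t adj \<longleftrightarrow> t \<le> graph_diameter adj \<and>
     (\<forall>l x y x' y'. graph_dist adj x y \<le> t \<and> graph_dist adj x' y' = graph_dist adj x y \<longrightarrow>
        card (walks adj l x y) = card (walks adj l x' y'))"

definition adjacency_matrix :: "('v::finite \<Rightarrow> 'v \<Rightarrow> bool) \<Rightarrow> real^'v^'v" where
  "adjacency_matrix adj = (\<chi> x y. if adj x y then 1 else 0)"

definition distance_matrix :: "('v::finite \<Rightarrow> 'v \<Rightarrow> bool) \<Rightarrow> nat \<Rightarrow> real^'v^'v" where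
  "distance_matrix adj j = (\<chi> x y. if graph_dist adj x y = j then 1 else 0)"

definition entrywise_product :: "real^'v^'v \<Rightarrow> real^'v^'v \<Rightarrow> real^'v^'v" where
  "entrywise_product M N = (\<chi> x y. M $ x $ y * N $ x $ y)"

definition walk_regular_idempotent ::
    "nat \<Rightarrow> ('v::finite \<Rightarrow> 'v \<Rightarrow> bool) \<Rightarrow> real \<Rightarrow> real^'v^'v \<Rightarrow> bool" where
  "walk_regular_idempotent t adj \<theta> E \<longleftrightarrow>
     E \<noteq> 0 \<and> transpose E = E \<and> E ** E = E \<and>
     adjacency_matrix adj ** E = \<theta> *\<^sub>R E \<and>
     (\<exists>\<alpha>::nat \<Rightarrow> real. \<forall>j\<le>t.
        entrywise_product (distance_matrix adj j) E = \<alpha> j *\<^sub>R distance_matrix adj j)"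

end

theory Submission
  imports Defs
begin

text \<open>
  The columns of \<open>E\<close> represent the vertices by vectors of squared norm \<open>\<alpha>\<^sub>0\<close> whose inner products
  at distance \<open>1\<close> and \<open>2\<close> are \<open>\<alpha>\<^sub>1\<close> and \<open>\<alpha>\<^sub>2\<close>.  Projecting the neighbours of a vertex \<open>x\<close> onto the
  orthogonal complement of the column of \<open>x\<close> gives a spherical two-distance set of \<open>k\<close> points in
  dimension at most \<open>m - 1\<close>, and the polynomial method of Delsarte, Goethals and Seidel bounds its
  size.  The projection is injective because \<open>\<alpha>\<^sub>1 = \<theta> \<alpha>\<^sub>0 / k \<noteq> \<alpha>\<^sub>0\<close> and because \<open>\<alpha>\<^sub>2 = \<alpha>\<^sub>0\<close> would
  force \<open>\<theta>\<^sup>2 = k\<^sup>2\<close> (no triangles) or a complete multipartite graph (every edge in a triangle).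
\<close>

section \<open>Spherical two-distance sets\<close>

lemma inner_eq_sum_orthonormal:
  fixes B :: "'a::euclidean_space set"
  assumes "pairwise orthogonal B" "\<And>b. b \<in> B \<Longrightarrow> norm b = 1"
    and "finite B" "u \<in> span B"
  shows "u \<bullet> v = (\<Sum>b\<in>B. (b \<bullet> u) * (b \<bullet> v))"
proof -
  have "u = (\<Sum>b\<in>B. (b \<bullet> u) *\<^sub>R b)"
    using orthonormal_basis_expand[of B u] assms by (simp add: inner_commute)
  then have "u \<bullet> v = (\<Sum>b\<in>B. (b \<bullet> u) *\<^sub>R b) \<bullet> v"
    by simp
  then show ?thesis
    by (simp add: inner_sum_left)
qed

text \<open>The polynomial \<open>(w i \<bullet> v - c1) * (w i \<bullet> v - c2)\<close> vanishes
  at every \<open>w j\<close> with \<open>j \<noteq> i\<close> and is nonzero at \<open>w i\<close>.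
  These \<open>card N\<close> polynomials are therefore independent as functions on the points, and
  on the sphere they lie in the span of the quadratic and linear monomials in
  \<open>d = dim S\<close> orthonormal coordinates, of which there are
  \<open>d * (d + 3) / 2\<close>.\<close>

theorem spherical_two_distance_bound:
  fixes w :: "'i::finite \<Rightarrow> 'a::euclidean_space"
  assumes "subspace S" "w ` N \<subseteq> S"
    and norm: "\<And>i. i \<in> N \<Longrightarrow> w i \<bullet> w i = c0"
    and inner: "\<And>i j. i \<in> N \<Longrightarrow> j \<in> N \<Longrightarrow> i \<noteq> j \<Longrightarrow> w i \<bullet> w j = c1 \<or> w i \<bullet> w j = c2"
    and "c0 \<noteq> 0" "c0 \<noteq> c1" "c0 \<noteq> c2"
  shows "2 * card N \<le> dim S * (dim S + 3)"
proof -
  obtain B where B: "B \<subseteq> S" "pairwise orthogonal B" "\<And>b. b \<in> B \<Longrightarrow> norm b = 1"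
      "independent B" "card B = dim S" "span B = S"
    using orthonormal_basis_subspace[OF assms(1)] by blast
  have finB: "finite B"
    using B(4) by (rule independent_imp_finite)
  \<comment> \<open>Only the values at the points matter, so a polynomial is encoded as its vector
    of values; \<open>0\<close> outside \<open>N\<close> is a filler.\<close>
  define res :: "('a \<Rightarrow> real) \<Rightarrow> real^'i"
    where "res p = (\<chi> i. if i \<in> N then p (w i) else 0)" for p
  \<comment> \<open>The three families are the products of two distinct coordinates, the squares and
    the coordinates themselves. Coincidences among their values only make \<open>T\<close>
    smaller.\<close>
  define T where "T = (\<lambda>A. res (\<lambda>v. \<Prod>b\<in>A. b \<bullet> v)) ` {A. A \<subseteq> B \<and> card A = 2}
    \<union> (\<lambda>b. res (\<lambda>v. (b \<bullet> v)\<^sup>2)) ` B \<union> (\<lambda>b. res (\<lambda>v. b \<bullet> v)) ` B"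
  have finT: "finite T"
    unfolding T_def using finB by auto
  have "card T \<le> (card B choose 2) + card B + card B"
    unfolding T_def
    by (intro card_Un_le[THEN order_trans] add_mono card_image_le)
      (auto simp: finB n_subsets[OF finB, symmetric] intro!: card_image_le)
  then have "2 * card T \<le> 2 * (card B choose 2) + 4 * card B"
    by simp
  also have "\<dots> = card B * (card B + 3)"
    by (cases "card B") (auto simp: choose_two algebra_simps)
  finally have cardT: "2 * card T \<le> dim S * (dim S + 3)"
    unfolding B(5) .
  have quad: "res (\<lambda>v. (b \<bullet> v) * (c \<bullet> v)) \<in> span T" if "b \<in> B" "c \<in> B" for b c
  proof (cases "b = c")
    case True
    then show ?thesis
      using that by (intro span_base) (auto simp: T_def power2_eq_square)
  next
    case False
    then have "res (\<lambda>v. (b \<bullet> v) * (c \<bullet> v)) = res (\<lambda>v. \<Prod>b\<in>{b, c}. b \<bullet> v)"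
      by simp
    also have "\<dots> \<in> T"
      using that False unfolding T_def by (intro UnI1 imageI) auto
    finally show ?thesis
      by (rule span_base)
  qed
  have lin: "res (\<lambda>v. b \<bullet> v) \<in> span T" if "b \<in> B" for b
    using that by (intro span_base) (auto simp: T_def)
  have wS: "w i \<in> span B" if "i \<in> N" for i
    using that assms(2) B(6) by auto
  have expand: "w i \<bullet> v = (\<Sum>b\<in>B. (b \<bullet> w i) * (b \<bullet> v))" if "i \<in> N" for i v
    using inner_eq_sum_orthonormal[OF B(2,3) finB wS[OF that]] by simp
  have lin_i: "res (\<lambda>v. w i \<bullet> v) \<in> span T" if "i \<in> N" for i
  proof -
    have "res (\<lambda>v. w i \<bullet> v) = (\<Sum>b\<in>B. (b \<bullet> w i) *\<^sub>R res (\<lambda>v. b \<bullet> v))"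
      by (simp add: res_def vec_eq_iff expand[OF that])
    then show ?thesis
      by (simp add: span_sum span_mul lin)
  qed
  have quad_i: "res (\<lambda>v. (w i \<bullet> v)\<^sup>2) \<in> span T" if "i \<in> N" for i
  proof -
    have "res (\<lambda>v. (w i \<bullet> v)\<^sup>2) =
        (\<Sum>b\<in>B. \<Sum>c\<in>B. ((b \<bullet> w i) * (c \<bullet> w i)) *\<^sub>R res (\<lambda>v. (b \<bullet> v) * (c \<bullet> v)))"
      by (simp add: res_def vec_eq_iff expand[OF that] power2_eq_square sum_product mult_ac)
    then show ?thesis
      by (simp add: span_sum span_mul quad)
  qed
  \<comment> \<open>On the sphere the constants are quadratic forms; this saves one dimension.\<close>
  have const: "res (\<lambda>v. 1) \<in> span T"
  proof -
    have "res (\<lambda>v. 1) = (1 / c0) *\<^sub>R (\<Sum>b\<in>B. res (\<lambda>v. (b \<bullet> v) * (b \<bullet> v)))"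
      using norm assms(5) by (auto simp: res_def vec_eq_iff expand[symmetric])
    then show ?thesis
      by (simp add: span_sum span_mul quad)
  qed
  have "axis i 1 \<in> span T" if "i \<in> N" for i
  proof -
    \<comment> \<open>This is the product
      \<open>(w i \<bullet> v - c1) * (w i \<bullet> v - c2)\<close> expanded; on \<open>N\<close>
      it is a multiple of the indicator of \<open>i\<close>.\<close>
    have "((c0 - c1) * (c0 - c2)) *\<^sub>R axis i 1 =
        res (\<lambda>v. (w i \<bullet> v)\<^sup>2) - (c1 + c2) *\<^sub>R res (\<lambda>v. w i \<bullet> v) + (c1 * c2) *\<^sub>R res (\<lambda>v. 1)"
      (is "_ = ?p")
    proof -
      have "?p $ j = (if j \<in> N then (w i \<bullet> w j - c1) * (w i \<bullet> w j - c2) else 0)" for j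
        by (simp add: res_def power2_eq_square algebra_simps)
      then show ?thesis
        using that norm inner[OF that] by (auto simp: vec_eq_iff axis_def)
    qed
    moreover have "?p \<in> span T"
      using that by (intro span_add span_diff span_mul quad_i lin_i const)
    ultimately have "((c0 - c1) * (c0 - c2)) *\<^sub>R axis i 1 \<in> span T"
      by simp
    from span_mul[OF this, of "1 / ((c0 - c1) * (c0 - c2))"] show ?thesis
      using assms(6,7) by simp
  qed
  then have sub: "(\<lambda>i. axis i 1 :: real^'i) ` N \<subseteq> span T"
    by auto
  have "independent ((\<lambda>i. axis i 1 :: real^'i) ` N)"
    by (rule independent_mono[OF independent_Basis]) (auto simp: Basis_vec_def)
  then have "card ((\<lambda>i. axis i 1 :: real^'i) ` N) \<le> card T"
    using independent_span_bound[OF finT _ sub] by blast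
  moreover have "card ((\<lambda>i. axis i 1 :: real^'i) ` N) = card N"
    by (intro card_image inj_onI) (simp add: axis_eq_axis)
  ultimately show ?thesis
    using cardT by linarith
qed

section \<open>Distances at most two\<close>

lemma walks_0: "walks adj 0 x y = (if x = y then {[x]} else {})"
  by (auto simp: walks_def length_Suc_conv)

lemma walks_Suc_nonempty:
  "walks adj (Suc l) x y \<noteq> {} \<longleftrightarrow> (\<exists>z. adj x z \<and> walks adj l z y \<noteq> {})"
proof
  assume "walks adj (Suc l) x y \<noteq> {}"
  then obtain z zs where "length zs = l" "adj x z" "successively adj (z # zs)" "last (z # zs) = y"
    by (auto simp: walks_def length_Suc_conv)
  then have "z # zs \<in> walks adj l z y"
    by (simp add: walks_def)
  with \<open>adj x z\<close> show "\<exists>z. adj x z \<and> walks adj l z y \<noteq> {}"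
    by blast
next
  assume "\<exists>z. adj x z \<and> walks adj l z y \<noteq> {}"
  then obtain z xs where "adj x z" "xs \<in> walks adj l z y"
    by blast
  then have "x # xs \<in> walks adj (Suc l) x y"
    by (cases xs) (auto simp: walks_def)
  then show "walks adj (Suc l) x y \<noteq> {}"
    by blast
qed

lemma finite_walks: "finite (walks (adj :: 'v::finite \<Rightarrow> 'v \<Rightarrow> bool) l x y)"
  by (rule finite_subset[OF _ finite_lists_length_eq[of UNIV "Suc l"]]) (auto simp: walks_def)

lemma walks_1_nonempty: "walks adj (Suc 0) x y \<noteq> {} \<longleftrightarrow> adj x y"
  by (simp add: walks_Suc_nonempty walks_0)

lemma walks_2_nonempty: "walks adj 2 x y \<noteq> {} \<longleftrightarrow> (\<exists>z. adj x z \<and> adj z y)"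
  using walks_Suc_nonempty[of adj 1 x y] walks_1_nonempty[of adj _ y]
  by (simp add: numeral_2_eq_2)

lemma graph_dist_self: "graph_dist adj x x = 0"
  unfolding graph_dist_def by (rule Least_eq_0) (simp add: walks_0)

lemma graph_dist_adj:
  assumes "adj x y" "x \<noteq> y"
  shows "graph_dist adj x y = 1"
  unfolding graph_dist_def
proof (rule Least_equality)
  show "walks adj 1 x y \<noteq> {}"
    using assms by (simp add: walks_1_nonempty)
  show "1 \<le> l" if "walks adj l x y \<noteq> {}" for l
    using that assms by (cases l) (auto simp: walks_0)
qed

lemma graph_dist_2:
  assumes "adj x z" "adj z y" "x \<noteq> y" "\<not> adj x y"
  shows "graph_dist adj x y = 2"
  unfolding graph_dist_def
proof (rule Least_equality)
  show "walks adj 2 x y \<noteq> {}"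
    using assms by (auto simp: walks_2_nonempty)
  show "2 \<le> l" if "walks adj l x y \<noteq> {}" for l
  proof (rule ccontr)
    assume "\<not> 2 \<le> l"
    then have "l = 0 \<or> l = Suc 0"
      by linarith
    with that assms show False
      using walks_1_nonempty[of adj x y] by (auto simp: walks_0)
  qed
qed

text \<open>The fibres of \<open>f\<close> serve as the parts.\<close>

lemma complete_multipartiteI:
  assumes "\<And>x y. adj x y \<longleftrightarrow> f x \<noteq> f y"
  shows "complete_multipartite adj"
  unfolding complete_multipartite_def
proof (intro exI conjI allI)
  let ?P = "range (\<lambda>x. {y. f y = f x})"
  show "partition_on UNIV ?P"
    by (auto simp: partition_on_def disjoint_def)
  show "adj x y \<longleftrightarrow> \<not> (\<exists>p\<in>?P. x \<in> p \<and> y \<in> p)" for x y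
    unfolding assms by auto
qed

text \<open>The point is that the diameter is at most two: then distinct non-adjacent vertices have
  a common neighbour and hence equal \<open>f\<close>. On a path \<open>z, x, y, u\<close> with ends
  further apart, a common neighbour \<open>w\<close> of \<open>x\<close> and \<open>y\<close> gives
  a contradiction.\<close>

lemma complete_multipartite_if_triangles:
  fixes adj :: "'v \<Rightarrow> 'v \<Rightarrow> bool"
  assumes "simple_graph adj" "connected_graph adj"
    and triangle: "\<And>x y. adj x y \<Longrightarrow> \<exists>w. adj x w \<and> adj w y"
    and adj_neq: "\<And>x y. adj x y \<Longrightarrow> f x \<noteq> f y"
    and two_eq: "\<And>x y z. adj x z \<Longrightarrow> adj z y \<Longrightarrow> x \<noteq> y \<Longrightarrow> \<not> adj x y \<Longrightarrow> f x = f y"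
  shows "complete_multipartite adj"
proof (rule complete_multipartiteI)
  have sym: "adj x y \<Longrightarrow> adj y x" for x y
    using assms(1) by (auto simp: simple_graph_def dest: sympD)
  have within2: "z = u \<or> adj z u \<or> (\<exists>x. adj z x \<and> adj x u)" if "walks adj l z u \<noteq> {}" for l z u
    using that
  proof (induction l arbitrary: z)
    case 0
    then show ?case by (auto simp: walks_0 split: if_splits)
  next
    case (Suc l)
    then obtain x where zx: "adj z x" and "x = u \<or> adj x u \<or> (\<exists>y. adj x y \<and> adj y u)"
      unfolding walks_Suc_nonempty by blast
    then consider "x = u \<or> adj x u" | y where "adj x y" "adj y u"
      by blast
    then show ?case
    proof cases
      case 1
      with zx show ?thesis by blast
    next
      case (2 y)
      obtain w where w: "adj x w" "adj w y"
        using triangle[OF \<open>adj x y\<close>] by blast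
      show ?thesis
      proof (rule ccontr)
        assume far: "\<not> ?thesis"
        \<comment> \<open>Equality or adjacency in either pair would shorten the path from
          \<open>z\<close> to \<open>u\<close> to length at most two.\<close>
        then have "f z = f y" "f x = f u"
          using two_eq[of z x y] two_eq[of x y u] zx 2 sym by blast+
        \<comment> \<open>Otherwise \<open>w\<close> would be a common neighbour of \<open>z\<close>
          and \<open>u\<close>.\<close>
        have "\<not> adj z w \<or> \<not> adj w u"
          using far by blast
        then show False
        proof
          assume "\<not> adj z w"
          moreover have "z \<noteq> w"
            using far w 2 by blast
          ultimately have "f z = f w"
            using two_eq zx w by blast
          then show False
            using adj_neq[OF w(2)] \<open>f z = f y\<close> by simp
        next
          assume "\<not> adj w u"
          moreover have "w \<noteq> u"
            using far w zx by blast
          ultimately have "f w = f u"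
            using two_eq 2 w by blast
          then show False
            using adj_neq[OF w(1)] \<open>f x = f u\<close> by simp
        qed
      qed
    qed
  qed
  show "adj x y \<longleftrightarrow> f x \<noteq> f y" for x y
    using assms(2) within2 two_eq adj_neq unfolding connected_graph_def by metis
qed

text \<open>The number of walks of length two is the same between the ends of every edge, so either
  all edges lie in triangles or none does.\<close>

lemma triangle_transfer:
  assumes "simple_graph adj" "walk_regular 2 adj" "adj x y" "adj x' y'" "adj x z" "adj z y"
  shows "\<exists>z'. adj x' z' \<and> adj z' y'"
proof -
  have "graph_dist adj x y = 1" "graph_dist adj x' y' = 1"
    using assms by (auto intro!: graph_dist_adj simp: simple_graph_def irreflp_def
        simp del: One_nat_def)
  then have "card (walks adj 2 x y) = card (walks adj 2 x' y')"
    using assms(2) unfolding walk_regular_def by (metis one_le_numeral)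
  then have "walks adj 2 x' y' \<noteq> {}"
    using assms(5,6) walks_2_nonempty[of adj x y]
    by (metis card.empty card_0_eq finite_walks)
  then show ?thesis
    by (simp add: walks_2_nonempty)
qed

section \<open>Walk-regular idempotents\<close>

text \<open>The conclusions are phrased by adjacency and common neighbours, so that distances do not
  occur in the main argument.\<close>

lemma walk_regular_idempotent_entries:
  assumes "simple_graph adj" "walk_regular_idempotent 2 adj \<theta> E"
  obtains a0 a1 a2 where
    "\<And>x. E $ x $ x = a0"
    "\<And>x y. adj x y \<Longrightarrow> E $ x $ y = a1"
    "\<And>x y z. adj x z \<Longrightarrow> adj z y \<Longrightarrow> x \<noteq> y \<Longrightarrow> \<not> adj x y \<Longrightarrow> E $ x $ y = a2"
proof -
  obtain \<alpha> :: "nat \<Rightarrow> real" where \<alpha>: "\<And>j. j \<le> 2 \<Longrightarrow>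
      entrywise_product (distance_matrix adj j) E = \<alpha> j *\<^sub>R distance_matrix adj j"
    using assms(2) unfolding walk_regular_idempotent_def by blast
  have entry: "E $ x $ y = \<alpha> (graph_dist adj x y)" if "graph_dist adj x y \<le> 2" for x y
    using arg_cong[OF \<alpha>[OF that], of "\<lambda>M. M $ x $ y"]
    by (simp add: entrywise_product_def distance_matrix_def)
  have irr: "\<not> adj x x" for x
    using assms(1) by (simp add: simple_graph_def irreflp_def)
  show ?thesis
  proof (rule that)
    show "E $ x $ x = \<alpha> 0" for x
      using entry[of x x] by (simp add: graph_dist_self)
    show "E $ x $ y = \<alpha> 1" if "adj x y" for x y
      using entry[of x y] graph_dist_adj[of adj x y] that irr by fastforce
    show "E $ x $ y = \<alpha> 2" if "adj x z" "adj z y" "x \<noteq> y" "\<not> adj x y" for x y z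
      using entry[of x y] graph_dist_2[OF that] by simp
  qed
qed

text \<open>A symmetric idempotent is the Gram matrix of its own columns.\<close>

lemma inner_column_idempotent:
  fixes E :: "real^'v^'v"
  assumes "transpose E = E" "E ** E = E"
  shows "column x E \<bullet> column y E = E $ x $ y"
proof -
  have "E $ x $ y = (transpose E ** E) $ x $ y"
    using assms by simp
  then show ?thesis
    by (simp add: matrix_matrix_mult_def transpose_def inner_vec_def column_def)
qed

lemma eigen_neighbour_sum:
  assumes "adjacency_matrix adj ** E = \<theta> *\<^sub>R E"
  shows "(\<Sum>y | adj x y. E $ y $ z) = \<theta> * E $ x $ z"
proof -
  have "(adjacency_matrix adj ** E) $ x $ z = (\<Sum>y | adj x y. E $ y $ z)"
    by (simp add: matrix_matrix_mult_def adjacency_matrix_def if_distrib[of "\<lambda>t. t * _"]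
        sum.If_cases cong: if_cong)
  then show ?thesis
    using assms by simp
qed

theorem theorem4p3:
  fixes adj :: "'v::finite \<Rightarrow> 'v \<Rightarrow> bool"
    and E :: "real^'v^'v"
    and \<theta> :: real
    and k m :: nat
  assumes "simple_graph adj"
    and "connected_graph adj"
    and "walk_regular 2 adj"
    and "\<not> complete_multipartite adj"
    and "regular_graph adj k"
    and "k \<ge> 3"
    and "walk_regular_idempotent 2 adj \<theta> E"
    and "rank E = m"
    and "\<theta> \<noteq> real k"
    and "\<theta> \<noteq> - real k"
  shows "real k \<le> (real m + 2) * (real m - 1) / 2"
proof -
  have sym: "adj x y \<Longrightarrow> adj y x" for x y
    using assms(1) by (auto simp: simple_graph_def dest: sympD)
  have irr: "\<not> adj x x" for x
    using assms(1) by (simp add: simple_graph_def irreflp_def)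
  have deg: "card {y. adj x y} = k" for x
    using assms(5) by (simp add: regular_graph_def)
  have E: "E \<noteq> 0" "transpose E = E" "E ** E = E" "adjacency_matrix adj ** E = \<theta> *\<^sub>R E"
    using assms(7) by (auto simp: walk_regular_idempotent_def)
  obtain a0 a1 a2 where
    a0: "\<And>x. E $ x $ x = a0" and
    a1: "\<And>x y. adj x y \<Longrightarrow> E $ x $ y = a1" and
    a2: "\<And>x y z. adj x z \<Longrightarrow> adj z y \<Longrightarrow> x \<noteq> y \<Longrightarrow> \<not> adj x y \<Longrightarrow> E $ x $ y = a2"
    using walk_regular_idempotent_entries[OF assms(1,7)] by blast
  define f where "f y = column y E" for y
  have f_inner: "f y \<bullet> f z = E $ y $ z" for y z
    unfolding f_def using E(2,3) by (rule inner_column_idempotent)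
  have "a0 \<noteq> 0"
  proof
    assume "a0 = 0"
    then have "f y = 0" for y
      using f_inner[of y y] a0 by simp
    then have "E = 0"
      by (simp add: f_def column_def vec_eq_iff)
    with E(1) show False ..
  qed
  have ka1: "k * a1 = \<theta> * a0"
  proof -
    fix x
    have "(\<Sum>y | adj x y. E $ y $ x) = (\<Sum>y | adj x y. a1)"
      by (intro sum.cong) (auto intro: a1 sym)
    then show ?thesis
      using eigen_neighbour_sum[OF E(4), where x = x and z = x] deg a0 by simp
  qed
  have "a0 \<noteq> a1"
    using ka1 \<open>a0 \<noteq> 0\<close> assms(9) by auto
  have sq: "\<theta>\<^sup>2 \<noteq> (real k)\<^sup>2"
    using assms(9,10) by (simp add: power2_eq_iff)
  have "a0 \<noteq> a2"
  proof
    assume "a0 = a2"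
    show False
    \<comment> \<open>One triangle puts every edge in a triangle, and then \<open>f\<close>
      separates the parts of a complete multipartite graph.\<close>
    proof (cases "\<exists>x y z. adj x y \<and> adj x z \<and> adj z y")
      case True
      then have "\<exists>w. adj x w \<and> adj w y" if "adj x y" for x y
        using triangle_transfer[OF assms(1,3)] that by blast
      moreover have "f x \<noteq> f y" if "adj x y" for x y
        using f_inner[of x x] f_inner[of x y] a0 a1[OF that] \<open>a0 \<noteq> a1\<close> by auto
      moreover have "f x = f y" if "adj x z" "adj z y" "x \<noteq> y" "\<not> adj x y" for x y z
      proof -
        have "\<not> adj y x"
          using that(4) sym by blast
        then have "E $ x $ y = a0" "E $ y $ x = a0"
          using a2[OF that] a2[OF sym[OF that(2)] sym[OF that(1)] that(3)[symmetric]] \<open>a0 = a2\<close>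
          by simp_all
        \<comment> \<open>Vectors whose inner product equals both squared norms coincide.\<close>
        then have "(f x - f y) \<bullet> (f x - f y) = 0"
          by (simp add: inner_diff_left inner_diff_right f_inner a0)
        then show ?thesis
          by simp
      qed
      ultimately have "complete_multipartite adj"
        by (rule complete_multipartite_if_triangles[OF assms(1,2)])
      with assms(4) show False ..
    next
      case False
      fix x
      obtain y where "adj x y"
        using deg[of x] assms(6) by force
      \<comment> \<open>Without triangles, distinct neighbours of \<open>x\<close> are at distance
        two. The eigenvalue equation at the edge \<open>x\<close>, \<open>y\<close> then reads
        \<open>k * a0 = \<theta> * a1\<close>, which with \<open>ka1\<close> forces
        \<open>\<theta>\<^sup>2 = k\<^sup>2\<close>.\<close>
      have "E $ z $ y = a0" if "adj x z" for z
      proof (cases "z = y")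
        case False
        have "\<not> adj z y"
          using \<open>\<not> (\<exists>x y z. adj x y \<and> adj x z \<and> adj z y)\<close> that \<open>adj x y\<close> by blast
        then show ?thesis
          using a2[OF sym[OF that] \<open>adj x y\<close> False] \<open>a0 = a2\<close> by simp
      qed (simp add: a0)
      then have "k * a0 = \<theta> * a1"
        using eigen_neighbour_sum[OF E(4), where x = x and z = y] a1[OF \<open>adj x y\<close>] deg by simp
      then have "(real k)\<^sup>2 * a0 = \<theta>\<^sup>2 * a0"
        using ka1 by (metis mult.assoc mult.left_commute power2_eq_square)
      then show False
        using \<open>a0 \<noteq> 0\<close> sq by simp
    qed
  qed
  fix x
  \<comment> \<open>The coefficient is \<open>(f x \<bullet> f y) / (f x \<bullet> f x)\<close> for
    a neighbour \<open>y\<close> of \<open>x\<close>, so \<open>w y\<close> is orthogonal to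
    \<open>f x\<close>.\<close>
  define w where "w y = f y - (a1 / a0) *\<^sub>R f x" for y
  define N where "N = {y. adj x y}"
  define S where "S = {v \<in> span (columns E). f x \<bullet> v = 0}"
  have f_in: "f y \<in> span (columns E)" for y
    by (intro span_base) (auto simp: f_def columns_def)
  have "subspace S"
    unfolding S_def by (auto simp: subspace_def span_zero span_add span_scale inner_right_distrib)
  have w_inner: "w y \<bullet> w z = E $ y $ z - a1\<^sup>2 / a0" if "y \<in> N" "z \<in> N" for y z
    using that a1[of x y] a1[of y x] a1[of x z] sym[of x y] a0[of x] \<open>a0 \<noteq> 0\<close>
    by (simp add: N_def w_def inner_diff_left inner_diff_right f_inner field_simps power2_eq_square)
  have "2 * card N \<le> dim S * (dim S + 3)"
  proof (rule spherical_two_distance_bound[OF \<open>subspace S\<close>])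
    show "w ` N \<subseteq> S"
      using \<open>a0 \<noteq> 0\<close>
      by (auto simp: S_def w_def N_def inner_diff_right f_inner a0 a1 intro: span_diff span_mul f_in)
    show "w y \<bullet> w y = a0 - a1\<^sup>2 / a0" if "y \<in> N" for y
      using that by (simp add: w_inner a0)
    show "w y \<bullet> w z = a1 - a1\<^sup>2 / a0 \<or> w y \<bullet> w z = a2 - a1\<^sup>2 / a0"
      if "y \<in> N" "z \<in> N" "y \<noteq> z" for y z
    proof (cases "adj y z")
      case False
      then show ?thesis
        \<comment> \<open>Two neighbours of \<open>x\<close> have \<open>x\<close> itself as a
          common neighbour.\<close>
        using that a2[of y x z] sym[of x y] by (simp add: w_inner N_def)
    qed (use that in \<open>simp add: w_inner a1\<close>)
    \<comment> \<open>If the projections vanished, \<open>a1\<^sup>2 = a0\<^sup>2\<close> and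
      \<open>ka1\<close> would give \<open>\<theta>\<^sup>2 = k\<^sup>2\<close>.\<close>
    show "a0 - a1\<^sup>2 / a0 \<noteq> 0"
    proof
      assume "a0 - a1\<^sup>2 / a0 = 0"
      then have "(real k * a1)\<^sup>2 = (real k)\<^sup>2 * a0\<^sup>2"
        using \<open>a0 \<noteq> 0\<close> by (simp add: field_simps power2_eq_square)
      then have "\<theta>\<^sup>2 * a0\<^sup>2 = (real k)\<^sup>2 * a0\<^sup>2"
        by (simp add: ka1 power_mult_distrib)
      then show False
        using \<open>a0 \<noteq> 0\<close> sq by simp
    qed
  qed (use \<open>a0 \<noteq> a1\<close> \<open>a0 \<noteq> a2\<close> in auto)
  moreover have "dim S < m"
  proof -
    \<comment> \<open>The nonzero vector \<open>f x\<close> lies in the column space but is not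
      orthogonal to itself, so passing to \<open>S\<close> loses a dimension.\<close>
    have "f x \<notin> S"
      using f_inner[of x x] a0 \<open>a0 \<noteq> 0\<close> by (simp add: S_def)
    moreover have "S \<subseteq> span (columns E)"
      by (auto simp: S_def)
    moreover have "span S = S"
      using \<open>subspace S\<close> by simp
    ultimately have "span S \<subset> span (columns E)"
      using f_in[of x] by blast
    then have "dim S < dim (columns E)"
      by (rule dim_psubset)
    then show ?thesis
      using assms(8) by (simp add: column_rank_def[symmetric])
  qed
  \<comment> \<open>The subtraction on naturals is not truncated here, since
    \<open>dim S < m\<close> makes \<open>m\<close> positive.\<close>
  then have "dim S * (dim S + 3) \<le> (m - 1) * (m - 1 + 3)"
    by (intro mult_mono) auto
  ultimately have "2 * k \<le> (m - 1) * (m + 2)"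
    using \<open>dim S < m\<close> deg[of x] by (simp add: N_def)
  then have "real (2 * k) \<le> real ((m - 1) * (m + 2))"
    by (simp only: of_nat_le_iff)
  then show ?thesis
    using \<open>dim S < m\<close> by (cases m) (simp_all add: algebra_simps)
qed

end
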